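(* Let $G$ be a connected graph on at least two vertices. Then $\mu^{-}(G)=2$ if and only if $G$ has a cut-edge.
   Context: A cut-edge is an edge whose removal disconnects the graph. For $X\subseteq V(G)$, two vertices $a,b$ are $X$-visible if there is a shortest $a,b$-path $P$ in $G$ with $V(P)\cap X\subseteq\{a,b\}$. A set $X$ is a mutual-visibility set if every two vertices of $X$ are $X$-visible; it is maximal if no proper superset is one. $\mu^{-}(G)$ is the minimum cardinality of a maximal mutual-visibility set of $G$. *)

theory Defs
  imports "Graph_Theory.Pair_Digraph" "Graph_Theory.Digraph_Component" "Graph_Theory.Vertex_Walk"
begin

text \<open>
  A finite simple graph is a \<open>pair_graph\<close>: a finite, loop-free, symmetric digraph,
  in which an undirected edge \<open>uv\<close> is the pair of arcs \<open>(u, v)\<close> and \<open>(v, u)\<close>.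
\<close>

definition cut_edge :: "'a pair_pre_digraph \<Rightarrow> 'a \<Rightarrow> 'a \<Rightarrow> bool" where
  "cut_edge G u v \<longleftrightarrow> (u, v) \<in> parcs G \<and>
     \<not> Digraph_Component.connected (with_proj (G\<lparr>parcs := parcs G - {(u, v), (v, u)}\<rparr>))"

definition path_between :: "'a pair_pre_digraph \<Rightarrow> 'a \<Rightarrow> 'a vwalk \<Rightarrow> 'a \<Rightarrow> bool" where
  "path_between G a p b \<longleftrightarrow> vpath p (with_proj G) \<and> hd p = a \<and> last p = b"

definition shortest_path :: "'a pair_pre_digraph \<Rightarrow> 'a \<Rightarrow> 'a vwalk \<Rightarrow> 'a \<Rightarrow> bool" where
  "shortest_path G a p b \<longleftrightarrow> path_between G a p b \<and>
     (\<forall>q. path_between G a q b \<longrightarrow> vwalk_length p \<le> vwalk_length q)"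

definition visible :: "'a pair_pre_digraph \<Rightarrow> 'a set \<Rightarrow> 'a \<Rightarrow> 'a \<Rightarrow> bool" where
  "visible G X a b \<longleftrightarrow> (\<exists>p. shortest_path G a p b \<and> set p \<inter> X \<subseteq> {a, b})"

definition mutual_visibility_set :: "'a pair_pre_digraph \<Rightarrow> 'a set \<Rightarrow> bool" where
  "mutual_visibility_set G X \<longleftrightarrow> X \<subseteq> pverts G \<and>
     (\<forall>a\<in>X. \<forall>b\<in>X. a \<noteq> b \<longrightarrow> visible G X a b)"

definition maximal_mutual_visibility_set :: "'a pair_pre_digraph \<Rightarrow> 'a set \<Rightarrow> bool" where
  "maximal_mutual_visibility_set G X \<longleftrightarrow> mutual_visibility_set G X \<and>
     \<not> (\<exists>Y. X \<subset> Y \<and> mutual_visibility_set G Y)"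

text \<open>
  For a finite graph the family minimised over is finite, and it is nonempty because
  the empty set is a mutual-visibility set.
\<close>
definition mu_minus :: "'a pair_pre_digraph \<Rightarrow> nat" where
  "mu_minus G = Min (card ` {X. maximal_mutual_visibility_set G X})"

end

theory Submission
  imports Defs
begin

text \<open>
  If \<open>uv\<close> is a cut-edge, then \<open>{u, v}\<close> is maximal: a further vertex \<open>w\<close> lies on one side of the
  cut, so that all its paths to the far end of \<open>uv\<close> pass through the near end.

  Conversely, let \<open>{x, y}\<close> be maximal, \<open>d\<close> the distance of \<open>x\<close> and \<open>y\<close>, and \<open>P\<close> a shortest path
  from \<open>x\<close> to \<open>y\<close>. A vertex \<open>w\<close> off \<open>P\<close> cannot be added to \<open>{x, y}\<close>, hence all shortest paths
  from \<open>x\<close> to \<open>w\<close> pass through \<open>y\<close>, or all those from \<open>y\<close> to \<open>w\<close> pass through \<open>x\<close>. Let \<open>S\<close> be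
  the set of all \<open>s\<close> whose distance to \<open>y\<close> is \<open>d\<close> plus the distance to \<open>x\<close>. Comparing distances
  along an edge that leaves \<open>S\<close>, the only such edge is the first edge of \<open>P\<close>, which is therefore
  a cut-edge.
\<close>

section \<open>Walks and the distance they define\<close>

lemma length_vwalk_to_vpath_le: "length (vwalk_to_vpath p) \<le> length p"
proof (induct p rule: vwalk_to_vpath_induct3)
  case (in_set x xs)
  then show ?case
    using length_dropWhile_le[of "\<lambda>y. y \<noteq> x" xs] by simp
qed auto

text \<open>Strictness is what later shows that a walk of minimal length repeats no vertex.\<close>

lemma length_vwalk_to_vpath_less:
  "\<not> distinct p \<Longrightarrow> length (vwalk_to_vpath p) < length p"
proof (induct p rule: vwalk_to_vpath_induct3)
  case (in_set x xs)
  then show ?case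
    using length_dropWhile_le[of "\<lambda>y. y \<noteq> x" xs]
      length_vwalk_to_vpath_le[of "dropWhile (\<lambda>y. y \<noteq> x) xs"] by simp
qed auto

definition walk_between :: "'a pair_pre_digraph \<Rightarrow> 'a \<Rightarrow> 'a vwalk \<Rightarrow> 'a \<Rightarrow> bool" where
  "walk_between G a p b \<longleftrightarrow> vwalk p (with_proj G) \<and> hd p = a \<and> last p = b"

text \<open>Minimising over walks rather than paths lets walks be joined and cut without any care
  for distinctness. A walk with \<open>n\<close> arcs has \<open>Suc n\<close> vertices.\<close>

definition hop_dist :: "'a pair_pre_digraph \<Rightarrow> 'a \<Rightarrow> 'a \<Rightarrow> nat" where
  "hop_dist G a b = (LEAST n. \<exists>p. walk_between G a p b \<and> length p = Suc n)"

lemma walk_between_nonempty: "walk_between G a p b \<Longrightarrow> p \<noteq> []"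
  by (auto simp: walk_between_def)

lemma walk_between_verts: "walk_between G a p b \<Longrightarrow> set p \<subseteq> pverts G"
  by (auto simp: walk_between_def vwalk_def)

lemma hop_dist_less_length:
  assumes "walk_between G a p b"
  shows "hop_dist G a b < length p"
proof -
  obtain n where n: "length p = Suc n"
    using walk_between_nonempty[OF assms] by (cases p) auto
  then show ?thesis
    unfolding hop_dist_def using assms by (auto simp: less_Suc_eq_le intro: Least_le)
qed

text \<open>The shared vertex \<open>b\<close> is kept only once, by \<open>tl\<close>, whence the
  \<open>Suc\<close>.\<close>

lemma walk_between_join:
  assumes "walk_between G a p b" "walk_between G b q c"
  shows "walk_between G a (p @ tl q) c" "Suc (length (p @ tl q)) = length p + length q"
proof -
  have j: "joinable p q" using assms by (auto simp: walk_between_def)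
  show "walk_between G a (p @ tl q) c"
    using assms j vwalk_joinI_vwalk[OF _ _ j] vwalk_join_hd[OF j] vwalk_join_last[OF j]
    by (auto simp: walk_between_def vwalk_join_def)
  show "Suc (length (p @ tl q)) = length p + length q"
    using walk_between_nonempty[OF assms(2)] by (cases q) auto
qed

lemma walk_between_split:
  assumes "walk_between G a p b" "i < length p"
  shows "walk_between G a (take (Suc i) p) (p ! i)" "walk_between G (p ! i) (drop i p) b"
proof -
  have p: "vwalk p (with_proj G)" "hd p = a" "last p = b" "p \<noteq> []"
    using assms walk_between_nonempty[OF assms(1)] by (auto simp: walk_between_def)
  show "walk_between G a (take (Suc i) p) (p ! i)"
    unfolding walk_between_def
  proof (intro conjI)
    show "vwalk (take (Suc i) p) (with_proj G)"
      using vwalkI_append_l[of "take (Suc i) p" "drop (Suc i) p"] p by simp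
    show "last (take (Suc i) p) = p ! i"
      using assms(2) by (simp add: take_Suc_conv_app_nth)
  qed (use p in simp)
  show "walk_between G (p ! i) (drop i p) b"
    unfolding walk_between_def
    using vwalkI_append_r[of "drop i p" "take i p"] p assms(2)
    by (simp add: hd_drop_conv_nth)
qed

lemma walk_between_arc:
  assumes "pair_wf_digraph G" "(a, b) \<in> parcs G"
  shows "walk_between G a [a, b] b"
  using assms by (auto simp: walk_between_def vwalk_def pair_wf_digraph.in_arcsD1
      pair_wf_digraph.in_arcsD2)

lemma hop_dist_le_1:
  assumes "pair_wf_digraph G" "(a, b) \<in> parcs G"
  shows "hop_dist G a b \<le> 1"
  using hop_dist_less_length[OF walk_between_arc[OF assms]] by simp

lemma hop_dist_self: "a \<in> pverts G \<Longrightarrow> hop_dist G a a = 0"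
  using hop_dist_less_length[of G a "[a]" a] by (auto simp: walk_between_def vwalk_def)

context pair_sym_digraph
begin

text \<open>Connectedness is strong connectedness of the symmetric closure, and a symmetric digraph
  is its own closure. Stated without assuming connectedness, this also serves for the graph with an
  edge deleted.\<close>

lemma connected_iff_reachable:
  "Digraph_Component.connected (with_proj G) \<longleftrightarrow>
     pverts G \<noteq> {} \<and> (\<forall>u\<in>pverts G. \<forall>v\<in>pverts G. reachable (with_proj G) u v)"
  unfolding connected_def strongly_connected_def
  using reachable_mk_symmetric_eq[OF pair_sym_arcs] by simp

lemma walk_between_rev: "walk_between G a p b \<Longrightarrow> walk_between G b (rev p) a"
  using vwalk_rev_ex[OF pair_sym_arcs] walk_between_nonempty
  by (fastforce simp: walk_between_def hd_rev last_rev)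

lemma hop_dist_sym: "hop_dist G a b = hop_dist G b a"
proof -
  have "(\<exists>p. walk_between G a p b \<and> length p = n) \<longleftrightarrow> (\<exists>p. walk_between G b p a \<and> length p = n)"
    for n by (metis walk_between_rev length_rev)
  then show ?thesis by (simp add: hop_dist_def)
qed

end

section \<open>Distances and shortest paths in a connected graph\<close>

locale connected_pair_graph = pair_graph +
  assumes connected: "Digraph_Component.connected (with_proj G)"
begin

lemma walk_between_hop_dist:
  assumes "a \<in> pverts G" "b \<in> pverts G"
  obtains p where "walk_between G a p b" "length p = Suc (hop_dist G a b)"
proof -
  have "reachable (with_proj G) a b"
    using connected assms by (simp add: connected_iff_reachable)
  then obtain q where q: "walk_between G a q b"
    by (auto simp: reachable_vwalk_conv walk_between_def)
  have "\<exists>n p. walk_between G a p b \<and> length p = Suc n"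
    using q walk_between_nonempty[OF q] by (metis length_greater_0_conv gr0_implies_Suc)
  then have "\<exists>p. walk_between G a p b \<and> length p = Suc (hop_dist G a b)"
    unfolding hop_dist_def by (rule LeastI_ex)
  then show ?thesis using that by blast
qed

text \<open>Cutting loops out of a walk keeps its ends and does not lengthen it, so walks and paths
  have the same minimal length. It strictly shortens a walk with a repeated vertex, so a minimal
  walk is already a path.\<close>

lemma shortest_path_iff:
  "shortest_path G a p b \<longleftrightarrow> walk_between G a p b \<and> length p = Suc (hop_dist G a b)"
proof
  have path: "walk_between G a q b" if "path_between G a q b" for q
    using that by (auto simp: path_between_def walk_between_def)
  have vpath: "path_between G a (vwalk_to_vpath q) b" if "walk_between G a q b" for q
    using that by (simp add: path_between_def walk_between_def vwalk_to_vpath_vpath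
        vwalk_to_vpath_hd vwalk_to_vpath_last)
  {
    assume p: "shortest_path G a p b"
    then have w: "walk_between G a p b" by (auto simp: shortest_path_def path)
    then have "a \<in> pverts G" "b \<in> pverts G"
      using walk_between_verts[OF w] walk_between_nonempty[OF w]
      by (auto simp: walk_between_def)
    then obtain q where q: "walk_between G a q b" "length q = Suc (hop_dist G a b)"
      by (rule walk_between_hop_dist)
    have "length p - 1 \<le> length (vwalk_to_vpath q) - 1"
      using p vpath[OF q(1)] by (auto simp: shortest_path_def)
    then show "walk_between G a p b \<and> length p = Suc (hop_dist G a b)"
      using w q(2) hop_dist_less_length[OF w] length_vwalk_to_vpath_le[of q] by auto
  next
    assume p: "walk_between G a p b \<and> length p = Suc (hop_dist G a b)"
    have "distinct p"
      using hop_dist_less_length[OF path[OF vpath]] length_vwalk_to_vpath_less[of p] p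
      by fastforce
    then have "path_between G a p b"
      using p by (auto simp: path_between_def walk_between_def)
    moreover have "length p - 1 \<le> length q - 1" if "path_between G a q b" for q
      using hop_dist_less_length[OF path[OF that]] p by simp
    ultimately show "shortest_path G a p b" by (simp add: shortest_path_def)
  }
qed

lemma shortest_path_exists:
  assumes "a \<in> pverts G" "b \<in> pverts G"
  obtains p where "shortest_path G a p b"
proof -
  obtain p where "walk_between G a p b" "length p = Suc (hop_dist G a b)"
    using assms by (rule walk_between_hop_dist)
  then show ?thesis using that by (simp add: shortest_path_iff)
qed

lemma hop_dist_triangle:
  assumes "a \<in> pverts G" "b \<in> pverts G" "c \<in> pverts G"
  shows "hop_dist G a c \<le> hop_dist G a b + hop_dist G b c"
proof -
  obtain p q where p: "walk_between G a p b" "length p = Suc (hop_dist G a b)"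
    and q: "walk_between G b q c" "length q = Suc (hop_dist G b c)"
    using assms by (metis walk_between_hop_dist)
  show ?thesis
    using hop_dist_less_length[OF walk_between_join(1)[OF p(1) q(1)]]
      walk_between_join(2)[OF p(1) q(1)] p(2) q(2) by simp
qed

lemma hop_dist_arc:
  assumes "(b, c) \<in> parcs G" "a \<in> pverts G"
  shows "hop_dist G a c \<le> Suc (hop_dist G a b)"
  using hop_dist_triangle[OF assms(2), of b c] hop_dist_le_1[OF pair_wf_digraph assms(1)]
    in_arcsD1[OF assms(1)] in_arcsD2[OF assms(1)] by simp

lemma hop_dist_eq_0:
  assumes "a \<in> pverts G" "b \<in> pverts G" "hop_dist G a b = 0"
  shows "a = b"
proof -
  obtain p where "walk_between G a p b" "length p = Suc 0"
    using walk_between_hop_dist[OF assms(1,2)] assms(3) by auto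
  then show ?thesis by (cases p) (auto simp: walk_between_def)
qed

text \<open>The two pieces of the path bound the two distances from above. Their lengths add up to
  the whole distance, so the triangle inequality forces equality in both bounds.\<close>

lemma hop_dist_shortest_path_nth:
  assumes "shortest_path G a p b" "i < length p"
  shows "hop_dist G a (p ! i) = i" "hop_dist G a b = i + hop_dist G (p ! i) b"
proof -
  have p: "walk_between G a p b" "length p = Suc (hop_dist G a b)"
    using assms(1) by (auto simp: shortest_path_iff)
  have V: "a \<in> pverts G" "b \<in> pverts G" "p ! i \<in> pverts G"
    using walk_between_verts[OF p(1)] walk_between_nonempty[OF p(1)] p(1) assms(2)
    by (auto simp: walk_between_def)
  have "hop_dist G a (p ! i) \<le> i" "hop_dist G (p ! i) b < length p - i"
    using hop_dist_less_length[OF walk_between_split(1)[OF p(1) assms(2)]]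
      hop_dist_less_length[OF walk_between_split(2)[OF p(1) assms(2)]] assms(2)
    by simp_all
  moreover have "hop_dist G a b \<le> hop_dist G a (p ! i) + hop_dist G (p ! i) b"
    using hop_dist_triangle[OF V(1,3,2)] .
  ultimately show "hop_dist G a (p ! i) = i" "hop_dist G a b = i + hop_dist G (p ! i) b"
    using p(2) assms(2) by linarith+
qed

lemma hop_dist_shortest_path:
  assumes "shortest_path G a p b" "m \<in> set p"
  shows "hop_dist G a b = hop_dist G a m + hop_dist G m b"
proof -
  obtain i where "i < length p" "m = p ! i" using assms(2) by (auto simp: in_set_conv_nth)
  then show ?thesis using hop_dist_shortest_path_nth[OF assms(1)] by simp
qed

section \<open>Visibility and maximal mutual-visibility sets\<close>

lemma visible_sym: "visible G X a b \<Longrightarrow> visible G X b a"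
proof -
  assume "visible G X a b"
  then obtain p where p: "shortest_path G a p b" "set p \<inter> X \<subseteq> {a, b}"
    by (auto simp: visible_def)
  then have "shortest_path G b (rev p) a"
    by (auto simp: shortest_path_iff walk_between_rev hop_dist_sym[of b a])
  then show ?thesis using p(2) unfolding visible_def by (intro exI[of _ "rev p"]) auto
qed

text \<open>One shortest path is enough: the only obstacle it can meet is \<open>y\<close>, so
  \<open>y\<close> lies on it.\<close>

lemma hop_dist_blocked:
  assumes "x \<in> pverts G" "w \<in> pverts G" "\<not> visible G {x, y, w} x w"
  shows "hop_dist G x w = hop_dist G x y + hop_dist G y w"
proof -
  obtain p where p: "shortest_path G x p w"
    using shortest_path_exists[OF assms(1,2)] .
  then have "y \<in> set p" using assms(3) by (auto simp: visible_def)
  then show ?thesis using hop_dist_shortest_path[OF p] by blast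
qed

lemma visible_pair:
  assumes "a \<in> pverts G" "b \<in> pverts G"
  shows "visible G {a, b} a b"
proof -
  obtain p where "shortest_path G a p b" using assms by (rule shortest_path_exists)
  then show ?thesis by (auto simp: visible_def)
qed

lemma mutual_visibility_set_pair:
  assumes "a \<in> pverts G" "b \<in> pverts G"
  shows "mutual_visibility_set G {a, b}"
  using assms visible_pair[OF assms] visible_sym[OF visible_pair[OF assms]]
  by (auto simp: mutual_visibility_set_def)

lemma finite_maximal: "finite {X. maximal_mutual_visibility_set G X}"
  by (rule finite_subset[of _ "Pow (pverts G)"])
    (auto simp: maximal_mutual_visibility_set_def mutual_visibility_set_def pair_finite_verts)

lemma maximal_exists: "\<exists>X. maximal_mutual_visibility_set G X"
proof -
  let ?M = "{X. mutual_visibility_set G X}"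
  have "finite ?M"
    by (rule finite_subset[of _ "Pow (pverts G)"])
      (auto simp: mutual_visibility_set_def pair_finite_verts)
  moreover have "{} \<in> ?M" by (simp add: mutual_visibility_set_def)
  ultimately obtain X where "X \<in> ?M" "\<forall>Y\<in>?M. X \<subseteq> Y \<longrightarrow> X = Y"
    using finite_has_maximal[of ?M] by blast
  then show ?thesis by (auto simp: maximal_mutual_visibility_set_def)
qed

text \<open>A set with at most one vertex extends properly to a pair, and every pair is a
  mutual-visibility set.\<close>

lemma card_maximal_ge_2:
  assumes "2 \<le> card (pverts G)" "maximal_mutual_visibility_set G X"
  shows "2 \<le> card X"
proof (rule ccontr)
  assume "\<not> 2 \<le> card X"
  have X: "X \<subseteq> pverts G"
    using assms(2) by (simp add: maximal_mutual_visibility_set_def mutual_visibility_set_def)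
  then have "finite X" using pair_finite_verts finite_subset by blast
  with \<open>\<not> 2 \<le> card X\<close> obtain a where a: "X \<subseteq> {a}" "a \<in> pverts G"
  proof (cases "X = {}")
    case True
    then show ?thesis using that assms(1) by (metis card.empty empty_iff ex_in_conv
          empty_subsetI not_numeral_le_zero)
  next
    case False
    then have "card X = 1"
      using \<open>finite X\<close> \<open>\<not> 2 \<le> card X\<close> card_gt_0_iff[of X] by linarith
    then show ?thesis using that X by (auto simp: card_1_singleton_iff)
  qed
  obtain b where b: "b \<in> pverts G" "b \<noteq> a"
    using assms(1) card_mono[of "{a}" "pverts G"] by fastforce
  have "X \<subset> {a, b}" using a b by auto
  then show False
    using mutual_visibility_set_pair[OF a(2) b(1)] assms(2)
    by (auto simp: maximal_mutual_visibility_set_def)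
qed

section \<open>Cut-edges give maximal pairs\<close>

lemma pair_sym_digraph_delete_edge:
  "pair_sym_digraph (G\<lparr>parcs := parcs G - {(u, v), (v, u)}\<rparr>)"
  by unfold_locales
    (auto simp: symmetric_def sym_def in_arcsD1 in_arcsD2 intro: arcs_symmetric)

lemma cut_edge_not_reachable:
  assumes "cut_edge G u v"
  shows "\<not> reachable (with_proj (G\<lparr>parcs := parcs G - {(u, v), (v, u)}\<rparr>)) u v"
proof
  let ?H = "G\<lparr>parcs := parcs G - {(u, v), (v, u)}\<rparr>"
  interpret H: pair_sym_digraph ?H by (rule pair_sym_digraph_delete_edge)
  assume uv: "reachable (with_proj ?H) u v"
  then have vu: "reachable (with_proj ?H) v u" by (rule H.symmetric_reachable')
  \<comment> \<open>Each use of a deleted arc is replaced by a detour between \<open>u\<close> and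
    \<open>v\<close>.\<close>
  have "reachable (with_proj ?H) a b" if "reachable (with_proj G) a b" for a b
    using that
  proof (induct rule: reachable_induct)
    case base
    then show ?case by (auto intro: H.reachable_refl)
  next
    case (step b c)
    have "reachable (with_proj ?H) b c"
    proof (cases "(b, c) \<in> {(u, v), (v, u)}")
      case True
      then show ?thesis using uv vu by auto
    next
      case False
      then show ?thesis using step by (intro H.reachable_adjI) auto
    qed
    then show ?case using step H.reachable_trans by blast
  qed
  then have "Digraph_Component.connected (with_proj ?H)"
    using connected by (simp add: connected_iff_reachable H.connected_iff_reachable)
  then show False using assms by (simp add: cut_edge_def)
qed

lemma cut_edge_maximal:
  assumes "cut_edge G u v"
  shows "maximal_mutual_visibility_set G {u, v}"
proof -
  let ?H = "G\<lparr>parcs := parcs G - {(u, v), (v, u)}\<rparr>"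
  interpret H: pair_sym_digraph ?H by (rule pair_sym_digraph_delete_edge)
  have uv: "u \<in> pverts G" "v \<in> pverts G" "u \<noteq> v"
    using assms in_arcsD1 in_arcsD2 no_loops' by (auto simp: cut_edge_def)
  \<comment> \<open>Here \<open>c\<close> is the end of the edge other than \<open>b\<close>. The
    path witnessing visibility avoids \<open>c\<close>, while both deleted arcs contain
    \<open>c\<close>, so it survives the deletion.\<close>
  have H: "reachable (with_proj ?H) w b"
    if vis: "visible G Y w b" and "Y \<supseteq> {u, v}" "w \<notin> {u, v}" "(b = v \<and> c = u) \<or> (b = u \<and> c = v)"
    for Y w b c
  proof -
    obtain p where p: "walk_between G w p b" "set p \<inter> Y \<subseteq> {w, b}"
      using vis unfolding visible_def shortest_path_iff by blast
    then have "c \<notin> set p" using that(2,3,4) uv(3) by auto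
    then have "walk_between ?H w p b"
      using p(1) that(4) by (auto simp: walk_between_def vwalk_def dest: arcs_in_vwalk_arcs)
    then show ?thesis by (auto simp: H.reachable_vwalk_conv walk_between_def)
  qed
  have False if Y: "{u, v} \<subset> Y" "mutual_visibility_set G Y" for Y
  proof -
    obtain w where w: "w \<in> Y" "w \<notin> {u, v}" using Y(1) by blast
    have "visible G Y w u" "visible G Y w v"
      using Y w by (auto simp: mutual_visibility_set_def)
    then have "reachable (with_proj ?H) w u" "reachable (with_proj ?H) w v"
      using H[of Y w] Y(1) w(2) by blast+
    then have "reachable (with_proj ?H) u v"
      using H.symmetric_reachable' H.reachable_trans by blast
    then show False using cut_edge_not_reachable[OF assms] by simp
  qed
  then show ?thesis
    using mutual_visibility_set_pair[OF uv(1,2)]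
    by (auto simp: maximal_mutual_visibility_set_def)
qed

section \<open>Maximal pairs give cut-edges\<close>

lemma cut_edgeI:
  assumes "(u, v) \<in> parcs G" "u \<in> S" "v \<notin> S"
    and "\<And>s t. (s, t) \<in> parcs G \<Longrightarrow> s \<in> S \<Longrightarrow> t \<notin> S \<Longrightarrow> s = u \<and> t = v"
  shows "cut_edge G u v"
proof -
  let ?H = "G\<lparr>parcs := parcs G - {(u, v), (v, u)}\<rparr>"
  interpret H: pair_sym_digraph ?H by (rule pair_sym_digraph_delete_edge)
  \<comment> \<open>The only arc leaving \<open>S\<close> has been deleted, so no remaining arc
    leads out of \<open>S\<close>.\<close>
  have "t \<in> S" if "reachable (with_proj ?H) u t" for t
    using that
  proof (induct rule: H.reachable_induct)
    case base
    then show ?case using assms(2) by simp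
  next
    case (step s t)
    then show ?case using assms(4)[of s t] by auto
  qed
  then have "\<not> Digraph_Component.connected (with_proj ?H)"
    using assms(1,3) in_arcsD1 in_arcsD2 by (auto simp: H.connected_iff_reachable)
  then show ?thesis using assms(1) by (simp add: cut_edge_def)
qed

lemma maximal_pair_cut_edge:
  assumes "maximal_mutual_visibility_set G {x, y}" "x \<noteq> y"
  shows "\<exists>u v. cut_edge G u v"
proof -
  let ?d = "hop_dist G"
  have xy: "x \<in> pverts G" "y \<in> pverts G"
    using assms(1) by (auto simp: maximal_mutual_visibility_set_def mutual_visibility_set_def)
  have d0: "?d x y > 0" using hop_dist_eq_0[OF xy] assms(2) by auto
  obtain P where P: "shortest_path G x P y" using shortest_path_exists[OF xy] .
  have wP: "walk_between G x P y" and lP: "length P = Suc (?d x y)"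
    using P by (auto simp: shortest_path_iff)
  \<comment> \<open>Since \<open>P\<close> avoids \<open>w\<close>, it still shows \<open>x\<close>
    and \<open>y\<close> to each other; any failure of mutual visibility must involve
    \<open>w\<close>.\<close>
  have blocked: "\<not> visible G {x, y, w} x w \<or> \<not> visible G {x, y, w} y w"
    if w: "w \<in> pverts G" "w \<notin> set P" for w
  proof (rule ccontr)
    assume "\<not> ?thesis"
    then have v: "visible G {x, y, w} x w" "visible G {x, y, w} y w" by auto
    moreover have v': "visible G {x, y, w} x y"
      using P w(2) by (auto simp: visible_def)
    ultimately have "mutual_visibility_set G {x, y, w}"
      using visible_sym[OF v(1)] visible_sym[OF v(2)] visible_sym[OF v'] xy w
      by (auto simp: mutual_visibility_set_def)
    moreover have "w \<noteq> x" "w \<noteq> y"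
      using w(2) wP walk_between_nonempty[OF wP] by (auto simp: walk_between_def)
    then have "{x, y} \<subset> {x, y, w}" by blast
    ultimately show False using assms(1) by (auto simp: maximal_mutual_visibility_set_def)
  qed
  \<comment> \<open>These are the vertices that have a shortest path from \<open>y\<close> through
    \<open>x\<close>, as in the equation that \<open>hop_dist_blocked\<close> yields.\<close>
  define S where "S = {s \<in> pverts G. ?d y s = ?d x y + ?d x s}"
  have xS: "x \<in> S" using xy by (simp add: S_def hop_dist_self hop_dist_sym[of y x])
  have y_not: "?d y t = ?d x y - ?d x t" if "t \<in> set P" for t
    using hop_dist_shortest_path[OF P that] by (simp add: hop_dist_sym[of y t])
  have P1: "1 < length P" using lP d0 by simp
  have d1: "?d x (P ! 1) = 1" using hop_dist_shortest_path_nth(1)[OF P P1] .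
  have "cut_edge G x (P ! 1)"
  proof (rule cut_edgeI[of _ _ S])
    obtain q where "P = x # P ! 1 # q"
      using P1 wP by (cases P; cases "tl P") (auto simp: walk_between_def)
    then have "(x, P ! 1) \<in> set (vwalk_arcs P)" by (metis list.set_intros(1) vwalk_arcs.simps(3))
    then show "(x, P ! 1) \<in> parcs G" using wP by (auto simp: walk_between_def vwalk_def)
    show "x \<in> S" by fact
    show "P ! 1 \<notin> S"
      using y_not[OF nth_mem[OF P1]] d1 by (auto simp: S_def)
  next
    fix s t assume st: "(s, t) \<in> parcs G" "s \<in> S" "t \<notin> S"
    have V: "s \<in> pverts G" "t \<in> pverts G" using st(1) in_arcsD1 in_arcsD2 by auto
    have s: "?d y s = ?d x y + ?d x s" using st(2) by (simp add: S_def)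
    have ts: "?d y s \<le> Suc (?d y t)" "?d x t \<le> Suc (?d x s)"
      using hop_dist_arc[OF arcs_symmetric[OF st(1)] xy(2)] hop_dist_arc[OF st(1) xy(1)] .
    show "s = x \<and> t = P ! 1"
    proof (cases "t \<in> set P")
      case True
      have "?d x t \<noteq> 0" using hop_dist_eq_0[OF xy(1) V(2)] xS st(3) by auto
      moreover have "?d x t \<le> ?d x y" using hop_dist_shortest_path[OF P True] by simp
      \<comment> \<open>With d the distance of \<open>x\<close> and \<open>y\<close>, the arc gives
        d + d(x,s) <= d - d(x,t) + 1, so d(x,s) + d(x,t) <= 1.\<close>
      ultimately have "?d x t = 1" "?d x s = 0" using y_not[OF True] s ts by linarith+
      moreover obtain i where "i < length P" "t = P ! i" using True by (auto simp: in_set_conv_nth)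
      ultimately show ?thesis
        using hop_dist_shortest_path_nth(1)[OF P] hop_dist_eq_0[OF xy(1) V(1)] by force
    next
      case False
      \<comment> \<open>Were \<open>t\<close> hidden from \<open>y\<close> by \<open>x\<close>, it
        would belong to \<open>S\<close>.\<close>
      have "visible G {y, x, t} y t"
        using hop_dist_blocked[OF xy(2) V(2), of x] st(3) V(2)
        by (auto simp: S_def hop_dist_sym[of y x])
      then have nv: "\<not> visible G {x, y, t} x t"
        using blocked[OF V(2) False] by (simp add: insert_commute)
      \<comment> \<open>Together with the bounds along the arc, this equation gives 2d + d(x,s) - 1
        <= d(x,t) <= d(x,s) + 1, which leaves only d = 1.\<close>
      then have t: "?d x t = ?d x y + ?d y t" using hop_dist_blocked[OF xy(1) V(2)] by blast
      \<comment> \<open>Only adjacent \<open>x\<close> and \<open>y\<close> are left; then a shortest path from \<open>x\<close> to \<open>s\<close>, extended by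
        \<open>t\<close>, is a shortest path that avoids \<open>y\<close>.\<close>
      then have d: "?d x y = 1" "?d x t = Suc (?d x s)" using s ts d0 by linarith+
      obtain q where q: "walk_between G x q s" "length q = Suc (?d x s)"
        using walk_between_hop_dist[OF xy(1) V(1)] .
      then have sq: "shortest_path G x q s" by (simp add: shortest_path_iff)
      \<comment> \<open>Otherwise d(x,s) = d + d(y,s) = 2d + d(x,s), although d > 0.\<close>
      have "y \<notin> set q"
        using hop_dist_shortest_path[OF sq, of y] s d0 by auto
      have "walk_between G x (q @ [t]) t" "length (q @ [t]) = Suc (?d x t)"
        using walk_between_join[OF q(1) walk_between_arc[OF pair_wf_digraph st(1)]] q(2) d(2)
        by simp_all
      then have "shortest_path G x (q @ [t]) t" by (simp add: shortest_path_iff)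
      then have "visible G {x, y, t} x t"
        using \<open>y \<notin> set q\<close> unfolding visible_def by (intro exI[of _ "q @ [t]"]) auto
      then show ?thesis using nv by contradiction
    qed
  qed
  then show ?thesis by blast
qed

end

theorem theorem4p4:
  fixes G :: "'a pair_pre_digraph"
  assumes "pair_graph G"
    and "Digraph_Component.connected (with_proj G)"
    and "2 \<le> card (pverts G)"
  shows "mu_minus G = 2 \<longleftrightarrow> (\<exists>u v. cut_edge G u v)"
proof -
  interpret connected_pair_graph G
    using assms(1,2) by (simp add: connected_pair_graph_def connected_pair_graph_axioms_def)
  let ?M = "{X. maximal_mutual_visibility_set G X}"
  show ?thesis
  proof
    assume "mu_minus G = 2"
    \<comment> \<open>The family is finite and nonempty, so its minimum is attained.\<close>
    then have "2 \<in> card ` ?M"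
      using Min_in[of "card ` ?M"] finite_maximal maximal_exists by (auto simp: mu_minus_def)
    then obtain X where X: "maximal_mutual_visibility_set G X" "card X = 2" by auto
    then obtain x y where "X = {x, y}" "x \<noteq> y" by (auto simp: card_2_iff)
    then show "\<exists>u v. cut_edge G u v" using X(1) maximal_pair_cut_edge by blast
  next
    assume "\<exists>u v. cut_edge G u v"
    then obtain u v where uv: "cut_edge G u v" by blast
    then have "card {u, v} = 2" using no_loops' by (auto simp: cut_edge_def card_2_iff)
    then have "2 \<in> card ` ?M" using cut_edge_maximal[OF uv] by (metis imageI mem_Collect_eq)
    then show "mu_minus G = 2"
      unfolding mu_minus_def using finite_maximal card_maximal_ge_2[OF assms(3)]
      by (intro Min_eqI) auto
  qed
qed

end
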